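(* Let $G$ be a finite simple cobipartite graph with clique partition $(V_1,V_2)$ such that $V_1$ contains $k_1\ge1$ unsaturated vertices. Let $H$ be the graph obtained from $G$ by deleting all of the unsaturated vertices in $V_1$. Then $Z(G)=Z(H)+k_1-1$.
   Context: A clique partition $(V_1,V_2)$ of $G$ is a partition of $V(G)$ into two cliques; $G$ is cobipartite if one exists. A vertex of $V_1$ (resp. $V_2$) is unsaturated with respect to $(V_1,V_2)$ if it has no neighbor in $V_2$ (resp. $V_1$). $Z(G)$ is the zero forcing number: the smallest size of an initially filled set from which repeatedly applying "a filled vertex whose only unfilled neighbor is $u$ forces $u$ to become filled" fills all vertices.
   Formalization: The formal theorem additionally assumes that V_1 has at least two vertices; if V_1 is a single unsaturated (hence isolated) vertex, then Z(G)=Z(H)+1 and the stated formula always fails, e.g. for two isolated vertices. *)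

theory Defs
  imports "Graph_Theory.Graph_Theory"
begin

(* Finite simple graphs are the symmetric loop-free digraphs without parallel arcs of the
   locale graph; u is a neighbor of v iff v \<rightarrow>\<^bsub>G\<^esub> u.  The empty graph is allowed. *)

definition clique :: "('a, 'b) pre_digraph \<Rightarrow> 'a set \<Rightarrow> bool" where
  "clique G C \<longleftrightarrow> C \<subseteq> verts G \<and> (\<forall>u\<in>C. \<forall>v\<in>C. u \<noteq> v \<longrightarrow> u \<rightarrow>\<^bsub>G\<^esub> v)"

(* The two parts are ordered, and one of them may be empty. *)
definition clique_partition :: "('a, 'b) pre_digraph \<Rightarrow> 'a set \<Rightarrow> 'a set \<Rightarrow> bool" where
  "clique_partition G V1 V2 \<longleftrightarrow>
     V1 \<union> V2 = verts G \<and> V1 \<inter> V2 = {} \<and> clique G V1 \<and> clique G V2"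

definition cobipartite :: "('a, 'b) pre_digraph \<Rightarrow> bool" where
  "cobipartite G \<longleftrightarrow> (\<exists>V1 V2. clique_partition G V1 V2)"

(* For a clique partition (V1, V2), the unsaturated vertices of V1 are unsaturated G V1 V2
   and those of V2 are unsaturated G V2 V1. *)
definition unsaturated :: "('a, 'b) pre_digraph \<Rightarrow> 'a set \<Rightarrow> 'a set \<Rightarrow> 'a set" where
  "unsaturated G A B = {v \<in> A. \<forall>w\<in>B. \<not> v \<rightarrow>\<^bsub>G\<^esub> w}"

(* One application of the color change rule to the filled set F. *)
inductive force_step :: "('a, 'b) pre_digraph \<Rightarrow> 'a set \<Rightarrow> 'a set \<Rightarrow> bool"
  for G :: "('a, 'b) pre_digraph" where
  force: "v \<in> F \<Longrightarrow> {w. v \<rightarrow>\<^bsub>G\<^esub> w \<and> w \<notin> F} = {u} \<Longrightarrow> force_step G F (insert u F)"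

definition zero_forcing_set :: "('a, 'b) pre_digraph \<Rightarrow> 'a set \<Rightarrow> bool" where
  "zero_forcing_set G S \<longleftrightarrow> S \<subseteq> verts G \<and> (force_step G)\<^sup>*\<^sup>* S (verts G)"

definition zero_forcing_number :: "('a, 'b) pre_digraph \<Rightarrow> nat" where
  "zero_forcing_number G = (LEAST n. \<exists>S. zero_forcing_set G S \<and> card S = n)"

end

theory Submission
  imports Defs
begin

text \<open>
  Write \<open>U\<close> for the set of unsaturated vertices of \<open>V1\<close>. Its vertices have the same closed
  neighbourhood \<open>V1\<close>, so a zero forcing set of \<open>G\<close> misses at most one of them. If it misses
  \<open>u\<^sub>0\<close>, then \<open>V1\<close> is filled as soon as \<open>u\<^sub>0\<close> is, and before that only vertices of \<open>V2\<close>
  force, so the forces survive in \<open>H\<close>. If it contains \<open>U\<close>, then a vertex of \<open>U\<close> forces at most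
  one vertex, which can be filled in \<open>H\<close> from the start.

  Conversely, let \<open>S\<close> be a zero forcing set of \<open>H\<close> and look at its first force \<open>v \<rightarrow> w\<close>.
  If \<open>v \<in> V2\<close>, then \<open>V2\<close> is filled after it, from then on every vertex of \<open>V1\<close> that \<open>H\<close> forces
  can be forced from a neighbour in \<open>V2\<close>, and one vertex of \<open>U\<close> may be left unfilled until the
  end. If \<open>v \<in> V1\<close>, one takes all of \<open>U\<close> and drops \<open>v\<close> (when \<open>w \<in> V2\<close>) or a neighbour of \<open>v\<close>
  in \<open>V2\<close> (when \<open>w \<in> V1\<close>); the dropped vertex is recovered with the help of \<open>U\<close>.
\<close>

section \<open>Zero forcing as a closure\<close>

text \<open>The least set closed under the color change rule. The order of the forces disappears,
  and induction runs over single vertices.\<close>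

inductive_set forced :: "('a, 'b) pre_digraph \<Rightarrow> 'a set \<Rightarrow> 'a set"
  for G :: "('a, 'b) pre_digraph" and S :: "'a set" where
  init: "v \<in> S \<Longrightarrow> v \<in> forced G S"
| step: "v \<in> forced G S \<Longrightarrow> v \<rightarrow>\<^bsub>G\<^esub> u \<Longrightarrow> (\<And>w. v \<rightarrow>\<^bsub>G\<^esub> w \<Longrightarrow> w \<noteq> u \<Longrightarrow> w \<in> forced G S)
    \<Longrightarrow> u \<in> forced G S"

lemma force_stepE:
  assumes "force_step G F F'"
  obtains v u where "v \<in> F" "v \<rightarrow>\<^bsub>G\<^esub> u" "u \<notin> F" "F' = insert u F"
    "\<forall>w. v \<rightarrow>\<^bsub>G\<^esub> w \<longrightarrow> w \<noteq> u \<longrightarrow> w \<in> F"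
  using assms by cases blast

lemma force_steps_subset_forced:
  assumes "(force_step G)\<^sup>*\<^sup>* S F"
  shows "F \<subseteq> forced G S"
  using assms
proof (induction rule: rtranclp_induct)
  case base
  then show ?case by (auto intro: forced.init)
next
  case (step F F')
  obtain v u where vu: "v \<in> F" "v \<rightarrow>\<^bsub>G\<^esub> u" "u \<notin> F" "F' = insert u F"
    "\<forall>w. v \<rightarrow>\<^bsub>G\<^esub> w \<longrightarrow> w \<noteq> u \<longrightarrow> w \<in> F"
    using step.hyps(2) by (rule force_stepE)
  have "u \<in> forced G S"
    by (rule forced.step[of v]) (use vu step.IH in auto)
  then show ?case using vu(4) step.IH by simp
qed

lemma zero_forcing_set_iff:
  assumes "wf_digraph G" "finite (verts G)"
  shows "zero_forcing_set G S \<longleftrightarrow> S \<subseteq> verts G \<and> verts G \<subseteq> forced G S"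
proof
  assume "zero_forcing_set G S"
  then show "S \<subseteq> verts G \<and> verts G \<subseteq> forced G S"
    by (auto simp: zero_forcing_set_def dest: force_steps_subset_forced)
next
  interpret wf_digraph G by fact
  assume S: "S \<subseteq> verts G \<and> verts G \<subseteq> forced G S"
  \<comment> \<open>Every partial filling can be completed, whatever forces led to it; the induction
    is on the number of unfilled vertices.\<close>
  have "(force_step G)\<^sup>*\<^sup>* F (verts G)" if "S \<subseteq> F" "F \<subseteq> verts G" for F
    using that
  proof (induction "card (verts G - F)" arbitrary: F rule: less_induct)
    case less
    show ?case
    proof (cases "F = verts G")
      case False
      \<comment> \<open>Otherwise \<open>F\<close> would be closed under the rule, hence contain
        \<open>forced G S\<close> and with it all vertices.\<close>
      have "\<exists>v u. v \<in> F \<and> v \<rightarrow>\<^bsub>G\<^esub> u \<and> u \<notin> F \<and> (\<forall>w. v \<rightarrow>\<^bsub>G\<^esub> w \<longrightarrow> w \<noteq> u \<longrightarrow> w \<in> F)"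
      proof (rule ccontr)
        assume none: "\<not> ?thesis"
        have "x \<in> F" if "x \<in> forced G S" for x
          using that
        proof induction
          case (init v)
          then show ?case using less.prems(1) by blast
        next
          case (step v u)
          then show ?case using none by blast
        qed
        then show False using S False less.prems(2) by blast
      qed
      then obtain v u where vu: "v \<in> F" "v \<rightarrow>\<^bsub>G\<^esub> u" "u \<notin> F"
        "\<And>w. v \<rightarrow>\<^bsub>G\<^esub> w \<Longrightarrow> w \<noteq> u \<Longrightarrow> w \<in> F"
        by blast
      then have "force_step G F (insert u F)"
        by (intro force_step.force[of v]) auto
      moreover have u: "u \<in> verts G" using vu(2) adj_in_verts by blast
      have "card (verts G - insert u F) < card (verts G - F)"
        using assms(2) u vu(3) by (intro psubset_card_mono) auto
      then have "(force_step G)\<^sup>*\<^sup>* (insert u F) (verts G)"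
        using less.prems u by (intro less.hyps) auto
      ultimately show ?thesis by (rule converse_rtranclp_into_rtranclp)
    qed simp
  qed
  then show "zero_forcing_set G S" using S by (simp add: zero_forcing_set_def)
qed

lemma zero_forcing_number_le:
  "zero_forcing_set G S \<Longrightarrow> zero_forcing_number G \<le> card S"
  unfolding zero_forcing_number_def by (rule Least_le) blast

lemma zero_forcing_number_attained:
  obtains S where "zero_forcing_set G S" "card S = zero_forcing_number G"
proof -
  have "zero_forcing_set G (verts G)"
    by (simp add: zero_forcing_set_def)
  then have "\<exists>n S. zero_forcing_set G S \<and> card S = n" by blast
  then have "\<exists>S. zero_forcing_set G S \<and> card S = zero_forcing_number G"
    unfolding zero_forcing_number_def by (rule LeastI_ex)
  then show thesis using that by blast
qed

lemma adj_induce_subgraph_iff: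
  "u \<rightarrow>\<^bsub>G \<restriction> A\<^esub> v \<longleftrightarrow> u \<rightarrow>\<^bsub>G\<^esub> v \<and> u \<in> A \<and> v \<in> A"
  by (auto simp: arcs_ends_conv)

section \<open>Deleting the unsaturated vertices of one clique\<close>

locale two_clique_graph = graph G for G :: "('a, 'b) pre_digraph" +
  fixes V1 V2 :: "'a set"
  assumes partition: "clique_partition G V1 V2"
begin

abbreviation U :: "'a set" where "U \<equiv> unsaturated G V1 V2"

abbreviation H :: "('a, 'b) pre_digraph" where "H \<equiv> G \<restriction> (verts G - U)"

lemma verts_eq: "verts G = V1 \<union> V2"
  and disjoint: "v \<in> V1 \<Longrightarrow> v \<notin> V2"
  and adj_V1: "u \<in> V1 \<Longrightarrow> v \<in> V1 \<Longrightarrow> u \<noteq> v \<Longrightarrow> u \<rightarrow>\<^bsub>G\<^esub> v"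
  and adj_V2: "u \<in> V2 \<Longrightarrow> v \<in> V2 \<Longrightarrow> u \<noteq> v \<Longrightarrow> u \<rightarrow>\<^bsub>G\<^esub> v"
  using partition by (auto simp: clique_partition_def clique_def)

lemma adj_sym: "u \<rightarrow>\<^bsub>G\<^esub> v \<Longrightarrow> v \<rightarrow>\<^bsub>G\<^esub> u"
  using sym_arcs unfolding symmetric_def by (rule symD)

lemma adj_V1_or_V2:
  assumes "u \<rightarrow>\<^bsub>G\<^esub> v" shows "u \<in> V1 \<or> u \<in> V2" "v \<in> V1 \<or> v \<in> V2"
  using adj_in_verts[OF assms] verts_eq by auto

lemma U_V1: "u \<in> U \<Longrightarrow> u \<in> V1"
  by (simp add: unsaturated_def)

lemma adj_U_V1: "u \<in> U \<Longrightarrow> u \<rightarrow>\<^bsub>G\<^esub> w \<Longrightarrow> w \<in> V1"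
  using adj_V1_or_V2(2)[of u w] by (auto simp: unsaturated_def)

lemma U_adj_V1: "u \<in> U \<Longrightarrow> w \<rightarrow>\<^bsub>G\<^esub> u \<Longrightarrow> w \<in> V1"
  using adj_U_V1[OF _ adj_sym] .

lemma saturatedE:
  assumes "v \<in> V1" "v \<notin> U"
  obtains z where "z \<in> V2" "v \<rightarrow>\<^bsub>G\<^esub> z" "z \<rightarrow>\<^bsub>G\<^esub> v"
  using assms adj_sym unfolding unsaturated_def by blast

lemma adj_H: "u \<rightarrow>\<^bsub>H\<^esub> v \<longleftrightarrow> u \<rightarrow>\<^bsub>G\<^esub> v \<and> u \<notin> U \<and> v \<notin> U"
  using adj_in_verts by (auto simp: adj_induce_subgraph_iff)

lemma finite_U: "finite U"
  using finite_verts verts_eq by (auto simp: unsaturated_def)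

lemma zero_forcing_set_G_iff:
  "zero_forcing_set G S \<longleftrightarrow> S \<subseteq> verts G \<and> verts G \<subseteq> forced G S"
  by (rule zero_forcing_set_iff) (auto intro: wf_digraph)

lemma zero_forcing_set_H_iff:
  "zero_forcing_set H S \<longleftrightarrow> S \<subseteq> verts G - U \<and> verts G - U \<subseteq> forced H S"
  by (subst zero_forcing_set_iff) auto

section \<open>Lower bound for Z(G): from zero forcing sets of \<open>G\<close> to those of
  \<open>H\<close>\<close>

text \<open>A vertex of \<open>U\<close> can force only \<open>u0\<close> while \<open>u0\<close> is
  unfilled, and nothing once \<open>V1\<close> is filled. The second conjunct carries this through
  the induction: whatever forces \<open>u0\<close> lies in \<open>V1\<close> and sees the rest of
  \<open>V1\<close> filled.\<close>

lemma forced_H_if_unfilled: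
  assumes "(force_step G)\<^sup>*\<^sup>* S F" "u0 \<in> U" "u0 \<notin> S" "U - {u0} \<subseteq> S"
  shows "F - U \<subseteq> forced H (S - U) \<and> (u0 \<in> F \<longrightarrow> V1 \<subseteq> F)"
  using assms(1)
proof (induction rule: rtranclp_induct)
  case base
  then show ?case using assms(3) by (auto intro: forced.init)
next
  case (step F F')
  obtain v w where vw: "v \<in> F" "v \<rightarrow>\<^bsub>G\<^esub> w" "w \<notin> F" "F' = insert w F"
    "\<forall>x. v \<rightarrow>\<^bsub>G\<^esub> x \<longrightarrow> x \<noteq> w \<longrightarrow> x \<in> F"
    using step.hyps(2) by (rule force_stepE)
  have mono: "S \<subseteq> F" using step.hyps(1)
    by (induction rule: rtranclp_induct) (auto elim: force_stepE)
  have IH: "F - U \<subseteq> forced H (S - U)" "u0 \<in> F \<Longrightarrow> V1 \<subseteq> F"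
    using step.IH by auto
  show ?case
  proof (cases "w = u0")
    case True
    then have "v \<in> V1" using U_adj_V1 assms(2) vw(2) by blast
    then have "V1 \<subseteq> F'" using vw True adj_V1 by blast
    then show ?thesis using IH True vw(4) assms(2) by auto
  next
    case w: False
    have "w \<notin> U" using mono assms(4) w vw(3) by blast
    have "v \<notin> U"
    proof
      assume v: "v \<in> U"
      then have "w \<in> V1" using adj_U_V1 vw(2) by blast
      then have "u0 \<notin> F" using IH(2) vw(3) by blast
      then have "v \<noteq> u0" "\<not> v \<rightarrow>\<^bsub>G\<^esub> u0" using vw w by auto
      then show False using adj_V1 U_V1 v assms(2) by blast
    qed
    have "w \<in> forced H (S - U)"
      by (rule forced.step[of v]) (use vw IH(1) \<open>w \<notin> U\<close> \<open>v \<notin> U\<close> in \<open>auto simp: adj_H\<close>)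
    then show ?thesis using IH vw(4) w by auto
  qed
qed

text \<open>A force out of \<open>U\<close> completes \<open>V1\<close>, so there is at most one;
  its target \<open>w\<close> is granted to \<open>H\<close> from the start. The conjunct
  \<open>V1 \<subseteq> F\<close> excludes a second one.\<close>

lemma forced_H_if_filled:
  assumes "(force_step G)\<^sup>*\<^sup>* S F" "U \<subseteq> S"
  shows "F - U \<subseteq> forced H (S - U) \<or>
    (\<exists>w\<in>V1 - U. V1 \<subseteq> F \<and> F - U \<subseteq> forced H (insert w (S - U)))"
  using assms(1)
proof (induction rule: rtranclp_induct)
  case base
  then show ?case by (auto intro: forced.init)
next
  case (step F F')
  obtain v w where vw: "v \<in> F" "v \<rightarrow>\<^bsub>G\<^esub> w" "w \<notin> F" "F' = insert w F"
    "\<forall>x. v \<rightarrow>\<^bsub>G\<^esub> x \<longrightarrow> x \<noteq> w \<longrightarrow> x \<in> F"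
    using step.hyps(2) by (rule force_stepE)
  have mono: "S \<subseteq> F" using step.hyps(1)
    by (induction rule: rtranclp_induct) (auto elim: force_stepE)
  have w: "w \<notin> U" using mono assms(2) vw(3) by blast
  \<comment> \<open>\<open>T\<close> stands for either starting set, with or without the extra
    vertex.\<close>
  have H_step: "F' - U \<subseteq> forced H T" if "v \<notin> U" "F - U \<subseteq> forced H T" for T
  proof -
    have "w \<in> forced H T"
      by (rule forced.step[of v]) (use vw that w in \<open>auto simp: adj_H\<close>)
    then show ?thesis using that vw(4) by auto
  qed
  show ?case
  proof (cases "v \<in> U")
    case False
    then show ?thesis using step.IH H_step vw(4) by blast
  next
    case True
    then have v: "v \<in> V1" "w \<in> V1" using U_V1 adj_U_V1 vw(2) by auto
    then have "V1 \<subseteq> F'" using vw adj_V1 by blast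
    have "\<not> V1 \<subseteq> F" using v vw(3) by blast
    then have "F - U \<subseteq> forced H (S - U)" using step.IH by blast
    moreover have "forced H (S - U) \<subseteq> forced H (insert w (S - U))"
    proof
      fix x assume "x \<in> forced H (S - U)"
      then show "x \<in> forced H (insert w (S - U))"
      proof induction
        case (step v u)
        show ?case by (rule forced.step[of v]) (use step in auto)
      qed (auto intro: forced.init)
    qed
    ultimately have "F' - U \<subseteq> forced H (insert w (S - U))"
      using vw(4) by (auto intro: forced.init)
    then show ?thesis using \<open>V1 \<subseteq> F'\<close> v w by blast
  qed
qed

text \<open>A filled neighbour of one of these twins is also adjacent to the other, so it always
  sees two unfilled vertices.\<close>

lemma two_unfilled_never_forced:
  assumes "(force_step G)\<^sup>*\<^sup>* S F" "a \<in> U" "b \<in> U" "a \<noteq> b" "a \<notin> S" "b \<notin> S"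
  shows "a \<notin> F \<and> b \<notin> F"
  using assms(1)
proof (induction rule: rtranclp_induct)
  case base
  then show ?case using assms by simp
next
  case (step F F')
  obtain v w where vw: "v \<in> F" "v \<rightarrow>\<^bsub>G\<^esub> w" "w \<notin> F" "F' = insert w F"
    "\<forall>x. v \<rightarrow>\<^bsub>G\<^esub> x \<longrightarrow> x \<noteq> w \<longrightarrow> x \<in> F"
    using step.hyps(2) by (rule force_stepE)
  have "v \<in> V1" if "w = a \<or> w = b"
    using that U_adj_V1 vw(2) assms by blast
  then have "v \<rightarrow>\<^bsub>G\<^esub> a \<and> v \<rightarrow>\<^bsub>G\<^esub> b" if "w = a \<or> w = b"
    using that adj_V1 U_V1 assms step.IH vw(1) by metis
  then show ?case using vw(4,5) step.IH assms(4) by blast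
qed

text \<open>Passing to \<open>H\<close> removes all of \<open>U\<close> and adds at most one vertex,
  or removes all but one of \<open>U\<close> and adds none.\<close>

lemma zero_forcing_number_ge:
  assumes "U \<noteq> {}"
  shows "zero_forcing_number H + card U \<le> zero_forcing_number G + 1"
proof -
  obtain S where S: "zero_forcing_set G S" "card S = zero_forcing_number G"
    by (rule zero_forcing_number_attained)
  then have sub: "S \<subseteq> verts G" and steps: "(force_step G)\<^sup>*\<^sup>* S (verts G)"
    by (auto simp: zero_forcing_set_def)
  have fin: "finite S" using sub finite_verts finite_subset by blast
  have UV: "U \<subseteq> verts G" using U_V1 verts_eq by auto
  have card_S: "card S = card (S - U) + card (S \<inter> U)"
    using fin by (metis add.commute card_Int_Diff)
  show ?thesis
  proof (cases "U \<subseteq> S")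
    case True
    have "\<exists>T. T \<subseteq> verts G - U \<and> verts G - U \<subseteq> forced H T \<and> card T \<le> card (S - U) + 1"
      using forced_H_if_filled[OF steps True]
    proof
      assume "verts G - U \<subseteq> forced H (S - U)"
      then show ?thesis using sub by (intro exI[of _ "S - U"]) auto
    next
      assume "\<exists>w\<in>V1 - U. V1 \<subseteq> verts G \<and> verts G - U \<subseteq> forced H (insert w (S - U))"
      then obtain w where "w \<in> V1 - U" "verts G - U \<subseteq> forced H (insert w (S - U))" by blast
      then show ?thesis using sub fin verts_eq
        by (intro exI[of _ "insert w (S - U)"]) (auto simp: card_insert_if)
    qed
    then obtain T where "zero_forcing_set H T" "card T \<le> card (S - U) + 1"
      using zero_forcing_set_H_iff by blast
    then have "zero_forcing_number H \<le> card (S - U) + 1"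
      using zero_forcing_number_le le_trans by blast
    moreover have "S \<inter> U = U" using True by blast
    ultimately show ?thesis using card_S S(2) by simp
  next
    case False
    then obtain u0 where u0: "u0 \<in> U" "u0 \<notin> S" by blast
    have rest: "U - {u0} \<subseteq> S"
      using two_unfilled_never_forced[OF steps u0(1)] u0 UV by blast
    have "zero_forcing_set H (S - U)"
      using forced_H_if_unfilled[OF steps u0 rest] sub
      by (auto simp: zero_forcing_set_H_iff)
    then have "zero_forcing_number H \<le> card (S - U)"
      by (rule zero_forcing_number_le)
    moreover have "S \<inter> U = U - {u0}" using rest u0 by blast
    moreover have "card U = card (U - {u0}) + 1"
      using card_Suc_Diff1[OF finite_U u0(1)] by simp
    ultimately show ?thesis using card_S S(2) by simp
  qed
qed

section \<open>Upper bound for Z(G): from zero forcing sets of \<open>H\<close> to those of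
  \<open>G\<close>\<close>

text \<open>Only unfilled neighbours in \<open>U\<close> can block in \<open>G\<close> a force of
  \<open>H\<close>. Filling \<open>U\<close> removes them; filling \<open>V2\<close> allows another
  vertex to force instead.\<close>

lemma forced_H_subset_forced_G:
  assumes "S \<subseteq> forced G T" and UV2: "U \<subseteq> forced G T \<or> V2 \<subseteq> forced G T"
  shows "forced H S \<subseteq> forced G T"
proof
  fix x assume "x \<in> forced H S"
  then show "x \<in> forced G T"
  proof induction
    case (init v)
    then show ?case using assms(1) by blast
  next
    case (step v w)
    have vw: "v \<rightarrow>\<^bsub>G\<^esub> w" "v \<notin> U" "w \<notin> U" using step.hyps by (auto simp: adj_H)
    have nbrs: "y \<in> forced G T" if "v \<rightarrow>\<^bsub>G\<^esub> y" "y \<noteq> w" "y \<notin> U" for y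
      using step.IH that vw(2) by (auto simp: adj_H)
    show ?case
    proof (cases "U \<subseteq> forced G T")
      case True
      show ?thesis by (rule forced.step[of v]) (use True nbrs vw step.IH in auto)
    next
      case noU: False
      then have V2: "V2 \<subseteq> forced G T" using UV2 by blast
      show ?thesis
      proof (cases "v \<in> V2 \<or> w \<in> V2")
        case True
        moreover have "w \<in> forced G T" if "v \<in> V2"
        proof (rule forced.step[OF _ vw(1)])
          fix y assume "v \<rightarrow>\<^bsub>G\<^esub> y" "y \<noteq> w"
          moreover from this have "y \<notin> U" using U_adj_V1 disjoint that by blast
          ultimately show "y \<in> forced G T" by (intro nbrs)
        qed (use step.IH in blast)
        ultimately show ?thesis using V2 by blast
      next
        case False
        then have V1: "v \<in> V1" "w \<in> V1" using adj_V1_or_V2 vw(1) by auto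
        \<comment> \<open>\<open>z\<close> replaces \<open>v\<close> as the forcing vertex: it has
          no neighbour in \<open>U\<close>, and its neighbours in \<open>V1\<close> other than
          \<open>w\<close> are filled, being \<open>v\<close> or neighbours of \<open>v\<close> in
          \<open>H\<close>.\<close>
        then obtain z where z: "z \<in> V2" "z \<rightarrow>\<^bsub>G\<^esub> w" using saturatedE vw(3) by blast
        show ?thesis
        proof (rule forced.step[OF _ z(2)])
          fix y assume y: "z \<rightarrow>\<^bsub>G\<^esub> y" "y \<noteq> w"
          have "y \<notin> U" using y U_adj_V1 disjoint z by blast
          moreover have "y \<in> V1 \<or> y \<in> V2" using adj_V1_or_V2 y(1) by blast
          ultimately show "y \<in> forced G T"
            using V2 V1 y(2) step.IH(1) nbrs[of y] adj_V1[of v y] by blast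
        qed (use V2 z in blast)
      qed
    qed
  qed
qed

lemma ex_zero_forcing_set_G:
  assumes S: "zero_forcing_set H S" and u0: "u0 \<in> U" and V1: "card V1 \<ge> 2"
  shows "\<exists>x \<in> S \<union> U. zero_forcing_set G (S \<union> U - {x})"
proof -
  have sub: "S \<subseteq> verts G - U" and steps: "(force_step H)\<^sup>*\<^sup>* S (verts G - U)"
    and forced: "verts G - U \<subseteq> forced H S"
    using S zero_forcing_set_H_iff by (auto simp: zero_forcing_set_def)
  have UV: "U \<subseteq> verts G" using U_V1 verts_eq by auto
  \<comment> \<open>For a dropped vertex of \<open>S\<close>: once it is recovered, all of
    \<open>U\<close> is filled and every force of \<open>H\<close> carries over.\<close>
  have zfI: "zero_forcing_set G (S \<union> U - {x})"
    if "x \<in> S" "x \<in> forced G (S \<union> U - {x})" for x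
  proof -
    have base: "S \<union> U \<subseteq> forced G (S \<union> U - {x})"
      using that(2) by (auto intro: forced.init)
    then have "forced H S \<subseteq> forced G (S \<union> U - {x})"
      by (intro forced_H_subset_forced_G) auto
    then have "verts G \<subseteq> forced G (S \<union> U - {x})" using base forced by blast
    then show ?thesis using sub UV by (auto simp: zero_forcing_set_G_iff)
  qed
  have zf_u0: "zero_forcing_set G (S \<union> U - {u0})" if "V2 \<subseteq> forced G (S \<union> U - {u0})"
  proof -
    let ?T = "S \<union> U - {u0}"
    have "S \<subseteq> forced G ?T" using sub u0 by (auto intro: forced.init)
    then have "forced H S \<subseteq> forced G ?T" using that by (intro forced_H_subset_forced_G) auto
    then have others: "verts G - {u0} \<subseteq> forced G ?T"
      using forced by (auto intro: forced.init)
    \<comment> \<open>If \<open>V1\<close> were \<open>{u0}\<close>, then \<open>u0\<close> would be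
      isolated and nothing could force it.\<close>
    have "V1 \<noteq> {u0}" "V1 \<noteq> {}" using V1 by auto
    then obtain s where s: "s \<in> V1" "s \<noteq> u0" by blast
    have "u0 \<in> forced G ?T"
    proof (rule forced.step)
      show "s \<in> forced G ?T" using s others verts_eq by blast
      show "s \<rightarrow>\<^bsub>G\<^esub> u0" using s u0 U_V1 adj_V1 by blast
      show "y \<in> forced G ?T" if "s \<rightarrow>\<^bsub>G\<^esub> y" "y \<noteq> u0" for y
        using that others adj_in_verts by blast
    qed
    then show ?thesis using others sub UV by (auto simp: zero_forcing_set_G_iff)
  qed
  from steps show ?thesis
  proof (cases rule: converse_rtranclpE)
    case base
    \<comment> \<open>No force is made in \<open>H\<close>, so \<open>S\<close> already contains
      \<open>V2\<close>.\<close>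
    then have "V2 \<subseteq> S \<union> U - {u0}" using verts_eq u0 U_V1 disjoint by blast
    then show ?thesis using u0 by (intro bexI[of _ u0] zf_u0) (auto intro: forced.init)
  next
    case (step F)
    obtain v w where vwH: "v \<in> S" "v \<rightarrow>\<^bsub>H\<^esub> w" "w \<notin> S" "F = insert w S"
      "\<forall>x. v \<rightarrow>\<^bsub>H\<^esub> x \<longrightarrow> x \<noteq> w \<longrightarrow> x \<in> S"
      using step(1) by (rule force_stepE)
    then have vw: "v \<rightarrow>\<^bsub>G\<^esub> w" "v \<notin> U" "w \<notin> U" by (auto simp: adj_H)
    have nbrs: "y \<in> S \<union> U" if "v \<rightarrow>\<^bsub>G\<^esub> y" "y \<noteq> w" for y
      using vwH(5) vw(2) that by (auto simp: adj_H)
    have V1_filled: "V1 \<subseteq> insert w (S \<union> U)" if "v \<in> V1"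
      using that nbrs adj_V1 vwH(1) by blast
    consider "v \<in> V2" | "v \<in> V1" "w \<in> V2" | "v \<in> V1" "w \<in> V1"
      using adj_V1_or_V2 vw(1) by blast
    then show ?thesis
    proof cases
      case 1
      let ?T = "S \<union> U - {u0}"
      \<comment> \<open>\<open>v\<close> lies in \<open>V2\<close> and does not see
        \<open>u0\<close>, so its force survives without \<open>u0\<close>.\<close>
      have nbr: "y \<in> ?T" if "v \<rightarrow>\<^bsub>G\<^esub> y" "y \<noteq> w" for y
        using nbrs[OF that] 1 that u0 U_adj_V1 disjoint by blast
      have v: "v \<in> ?T" using vwH(1) vw(2) u0 by blast
      have "w \<in> forced G ?T"
        by (rule forced.step[of v]) (use v nbr vw(1) in \<open>auto intro: forced.init\<close>)
      moreover have "V2 \<subseteq> insert w ?T" using v nbr adj_V2 1 by blast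
      ultimately have "V2 \<subseteq> forced G ?T" by (auto intro: forced.init)
      then show ?thesis using zf_u0 u0 by blast
    next
      case 2
      let ?T = "S \<union> U - {v}"
      \<comment> \<open>As \<open>w\<close> is in \<open>V2\<close>, all of \<open>V1\<close> except
        \<open>v\<close> is filled, and \<open>u0\<close> sees only \<open>V1\<close>.\<close>
      have "v \<in> forced G ?T"
      proof (rule forced.step)
        show "u0 \<in> forced G ?T" using u0 vw(2) by (auto intro: forced.init)
        show "u0 \<rightarrow>\<^bsub>G\<^esub> v" using u0 vw(2) U_V1 2 adj_V1 by blast
        show "y \<in> forced G ?T" if "u0 \<rightarrow>\<^bsub>G\<^esub> y" "y \<noteq> v" for y
          using that V1_filled 2 disjoint adj_U_V1 u0 by (blast intro: forced.init)
      qed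
      then show ?thesis using zfI vwH(1) by blast
    next
      case 3
      obtain z where z: "z \<in> V2" "v \<rightarrow>\<^bsub>G\<^esub> z" using saturatedE 3(1) vw(2) by blast
      have zw: "z \<noteq> w" "z \<notin> V1" using z 3 disjoint by auto
      then have zS: "z \<in> S" using nbrs z U_V1 by blast
      let ?T = "S \<union> U - {z}"
      \<comment> \<open>The missing \<open>z\<close> is outside \<open>V1\<close> and does not
        hinder \<open>u0\<close>; once \<open>w\<close> is filled, \<open>z\<close> is the only
        unfilled neighbour of \<open>v\<close>.\<close>
      have w: "w \<in> forced G ?T"
      proof (rule forced.step)
        show "u0 \<in> forced G ?T" using u0 zw U_V1 by (auto intro: forced.init)
        show "u0 \<rightarrow>\<^bsub>G\<^esub> w" using u0 vw(3) U_V1 3 adj_V1 by blast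
        show "y \<in> forced G ?T" if "u0 \<rightarrow>\<^bsub>G\<^esub> y" "y \<noteq> w" for y
          using that V1_filled 3 zw(2) adj_U_V1 u0 by (blast intro: forced.init)
      qed
      have "z \<in> forced G ?T"
      proof (rule forced.step)
        show "v \<in> forced G ?T" using vwH(1) 3 zw by (auto intro: forced.init)
        show "v \<rightarrow>\<^bsub>G\<^esub> z" by fact
        show "y \<in> forced G ?T" if "v \<rightarrow>\<^bsub>G\<^esub> y" "y \<noteq> z" for y
          using that nbrs[of y] w by (cases "y = w") (auto intro: forced.init)
      qed
      then show ?thesis using zfI zS by blast
    qed
  qed
qed

lemma zero_forcing_number_le_H:
  assumes "U \<noteq> {}" "card V1 \<ge> 2"
  shows "zero_forcing_number G + 1 \<le> zero_forcing_number H + card U"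
proof -
  obtain u0 where "u0 \<in> U" using assms(1) by blast
  obtain S where S: "zero_forcing_set H S" "card S = zero_forcing_number H"
    by (rule zero_forcing_number_attained)
  obtain x where x: "x \<in> S \<union> U" "zero_forcing_set G (S \<union> U - {x})"
    using ex_zero_forcing_set_G[OF S(1) \<open>u0 \<in> U\<close> assms(2)] by blast
  have sub: "S \<subseteq> verts G - U" using S(1) by (auto simp: zero_forcing_set_H_iff)
  then have fin: "finite S" using finite_verts finite_subset by blast
  have "card (S \<union> U) = card S + card U"
    using fin finite_U sub by (intro card_Un_disjoint) auto
  moreover have "card (S \<union> U) = card (S \<union> U - {x}) + 1"
    using card_Suc_Diff1[OF _ x(1)] fin finite_U by simp
  ultimately show ?thesis using zero_forcing_number_le[OF x(2)] S(2) by simp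
qed

end

theorem theorem5p10:
  fixes G H :: "('a, 'b) pre_digraph" and V1 V2 :: "'a set" and k1 :: nat
  assumes "graph G"
    and "cobipartite G"
    and "clique_partition G V1 V2"
    and "card (unsaturated G V1 V2) = k1"
    and "k1 \<ge> 1"
    and "card V1 \<ge> 2"
    and "H = G \<restriction> (verts G - unsaturated G V1 V2)"
  shows "zero_forcing_number G = zero_forcing_number H + k1 - 1"
proof -
  interpret two_clique_graph G V1 V2
    by (intro two_clique_graph.intro two_clique_graph_axioms.intro assms)
  have "unsaturated G V1 V2 \<noteq> {}" using assms(4,5) by auto
  \<comment> \<open>The two bounds give Z(G) + 1 = Z(H) + \<open>k1\<close>, so the subtraction on
    naturals is exact.\<close>
  then show ?thesis
    using zero_forcing_number_ge zero_forcing_number_le_H assms(4,6,7) by simp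
qed

end
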